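(* Let $K$ be a commutative ring with unity (for example a field) and let $R$ be a not necessarily commutative unitary associative $K$-algebra. For any subset $H\subseteq R$ we have $\mathrm{L}_p(H)\,\mathrm{L}_q(H)\subseteq \mathrm{L}_{p+q-1}(H)$ for all integers $p,q\geq 1$, and $\mathrm{L}_\omega(H)$ is a $K$-subalgebra of $R$.
   Context: For elements of $R$, $[x,y]=xy-yx$. Left normed commutators are defined by $[x_1]_1=x_1$ and $[x_1,x_2,\ldots,x_m]_m=[\ldots[[x_1,x_2],x_3],\ldots,x_m]$. For $H\subseteq R$ and an integer $k\geq 1$, the $k$-th Lie centralizer of $H$ is $\mathrm{L}_k(H)=\{r\in R : [r,x_1,\ldots,x_k]_{k+1}=0 \text{ for all } x_1,\ldots,x_k\in H\}$, a $K$-submodule of $R$. The $\omega$-Lie centralizer of $H$ is $\mathrm{L}_\omega(H)=\bigcup_{k=1}^{\infty}\mathrm{L}_k(H)$. The product $\mathrm{L}_p(H)\mathrm{L}_q(H)$ consists of the products $rs$ with $r\in \mathrm{L}_p(H)$, $s\in\mathrm{L}_q(H)$ (equivalently for the inclusion, finite sums of these). *)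

theory Defs
  imports "HOL-Algebra.Module" "HOL-Algebra.Coset" "HOL-Algebra.Subrings"
begin

text \<open>
  The library locale \<open>algebra\<close> requires the multiplication of the algebra to be commutative;
  here \<open>R\<close> is only assumed to be a ring with unity.
\<close>

locale unital_algebra = module K R + ring R for K and R (structure) +
  assumes smult_mult_left:
      "\<lbrakk>a \<in> carrier K; x \<in> carrier R; y \<in> carrier R\<rbrakk> \<Longrightarrow>
        (a \<odot> x) \<otimes> y = a \<odot> (x \<otimes> y)"
    and smult_mult_right:
      "\<lbrakk>a \<in> carrier K; x \<in> carrier R; y \<in> carrier R\<rbrakk> \<Longrightarrow>
        x \<otimes> (a \<odot> y) = a \<odot> (x \<otimes> y)"

text \<open>Subalgebras contain the unity of \<open>R\<close>, since \<^const>\<open>subring\<close> does.\<close>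

locale unital_subalgebra = subring A R + submodule A K R for A and K and R (structure)

definition lie_bracket :: "('a, 'b) ring_scheme \<Rightarrow> 'a \<Rightarrow> 'a \<Rightarrow> 'a"
  where "lie_bracket R x y = x \<otimes>\<^bsub>R\<^esub> y \<ominus>\<^bsub>R\<^esub> y \<otimes>\<^bsub>R\<^esub> x"

text \<open>
  The list \<open>[x\<^sub>1, x\<^sub>2, \<dots>, x\<^sub>m]\<close> is sent to \<open>[\<dots>[[x\<^sub>1, x\<^sub>2], x\<^sub>3], \<dots>, x\<^sub>m]\<close>, and \<open>[x\<^sub>1]\<close> to \<open>x\<^sub>1\<close>.
  The value at the empty list is irrelevant.
\<close>

definition left_normed_commutator :: "('a, 'b) ring_scheme \<Rightarrow> 'a list \<Rightarrow> 'a"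
  where "left_normed_commutator R xs = foldl (lie_bracket R) (hd xs) (tl xs)"

definition lie_centralizer :: "('a, 'b) ring_scheme \<Rightarrow> nat \<Rightarrow> 'a set \<Rightarrow> 'a set"
  where "lie_centralizer R k H =
    {r \<in> carrier R. \<forall>xs. length xs = k \<and> set xs \<subseteq> H \<longrightarrow>
      left_normed_commutator R (r # xs) = \<zero>\<^bsub>R\<^esub>}"

definition omega_lie_centralizer :: "('a, 'b) ring_scheme \<Rightarrow> 'a set \<Rightarrow> 'a set"
  where "omega_lie_centralizer R H = (\<Union>k\<in>{1..}. lie_centralizer R k H)"

end

theory Submission
  imports Defs
begin

text \<open>
  For \<open>x \<in> H\<close> the map \<open>[\<cdot>, x]\<close> sends \<open>L\<^sub>k\<^sub>+\<^sub>1(H)\<close> into \<open>L\<^sub>k(H)\<close>, and this property characterises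
  \<open>L\<^sub>k\<^sub>+\<^sub>1(H)\<close>. Since \<open>[\<cdot>, x]\<close> is a \<open>K\<close>-linear derivation, the module properties follow by
  induction on \<open>k\<close>, and the product formula by induction on \<open>p + q\<close> from
  \<open>[rs, x] = [r, x]s + r[s, x]\<close>. The induction may start at \<open>L\<^sub>0(H) = 0\<close>.
\<close>

context ring
begin

lemma lie_bracket_closed [simp, intro]:
  "\<lbrakk>r \<in> carrier R; x \<in> carrier R\<rbrakk> \<Longrightarrow> lie_bracket R r x \<in> carrier R"
  by (simp add: lie_bracket_def)

lemma lie_bracket_zero_left: "x \<in> carrier R \<Longrightarrow> lie_bracket R \<zero> x = \<zero>"
  by (simp add: lie_bracket_def minus_eq)

lemma lie_bracket_one_left: "x \<in> carrier R \<Longrightarrow> lie_bracket R \<one> x = \<zero>"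
  by (simp add: lie_bracket_def minus_eq r_neg)

lemma lie_bracket_add_left:
  "\<lbrakk>r \<in> carrier R; s \<in> carrier R; x \<in> carrier R\<rbrakk> \<Longrightarrow>
    lie_bracket R (r \<oplus> s) x = lie_bracket R r x \<oplus> lie_bracket R s x"
  by (simp add: lie_bracket_def minus_eq l_distr r_distr minus_add a_ac)

lemma lie_bracket_a_inv_left:
  "\<lbrakk>r \<in> carrier R; x \<in> carrier R\<rbrakk> \<Longrightarrow> lie_bracket R (\<ominus> r) x = \<ominus> lie_bracket R r x"
  by (simp add: lie_bracket_def minus_eq l_minus r_minus minus_add)

text \<open>Leibniz rule: after expanding the right-hand side, the two mixed terms
  \<open>r \<otimes> (x \<otimes> s)\<close> cancel by associativity.\<close>

lemma lie_bracket_mult_left: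
  assumes "r \<in> carrier R" "s \<in> carrier R" "x \<in> carrier R"
  shows "lie_bracket R (r \<otimes> s) x = lie_bracket R r x \<otimes> s \<oplus> r \<otimes> lie_bracket R s x"
proof -
  have "lie_bracket R r x \<otimes> s \<oplus> r \<otimes> lie_bracket R s x
      = (r \<otimes> (x \<otimes> s) \<oplus> \<ominus> (x \<otimes> (r \<otimes> s))) \<oplus> (r \<otimes> (s \<otimes> x) \<oplus> \<ominus> (r \<otimes> (x \<otimes> s)))"
    using assms by (simp add: lie_bracket_def minus_eq l_distr r_distr l_minus r_minus m_assoc)
  also have "\<dots> = r \<otimes> (s \<otimes> x) \<oplus> \<ominus> (x \<otimes> (r \<otimes> s))"
    using assms by (simp add: a_ac r_neg1 r_neg2)
  also have "\<dots> = lie_bracket R (r \<otimes> s) x"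
    using assms by (simp add: lie_bracket_def minus_eq m_assoc)
  finally show ?thesis by simp
qed

lemma lie_centralizer_closed: "r \<in> lie_centralizer R k H \<Longrightarrow> r \<in> carrier R"
  by (simp add: lie_centralizer_def)

lemma lie_centralizer_0: "lie_centralizer R 0 H = {\<zero>}"
  by (auto simp: lie_centralizer_def left_normed_commutator_def)

text \<open>A left normed commutator is a left fold, so its first bracket can be split off. All
  later inductions on the index use this recursion instead of lists. That \<open>H\<close> lies in
  the carrier ensures that the bracket does too.\<close>

lemma lie_centralizer_Suc_iff:
  assumes "H \<subseteq> carrier R"
  shows "r \<in> lie_centralizer R (Suc k) H \<longleftrightarrow>
    r \<in> carrier R \<and> (\<forall>x\<in>H. lie_bracket R r x \<in> lie_centralizer R k H)"
proof -
  have "(\<forall>xs. length xs = Suc k \<and> set xs \<subseteq> H \<longrightarrow> foldl (lie_bracket R) r xs = \<zero>) \<longleftrightarrow>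
      (\<forall>x\<in>H. \<forall>xs. length xs = k \<and> set xs \<subseteq> H \<longrightarrow>
        foldl (lie_bracket R) (lie_bracket R r x) xs = \<zero>)" (is "?L \<longleftrightarrow> ?R")
  proof
    assume ?L
    then have "foldl (lie_bracket R) r (x # xs) = \<zero>"
      if "x \<in> H" "length xs = k" "set xs \<subseteq> H" for x xs
      \<comment> \<open>The fold must stay unevaluated here so that it matches the hypothesis at the
        list \<open>x # xs\<close>.\<close>
      using that by (simp del: foldl_Cons)
    then show ?R by simp
  qed (auto simp: length_Suc_conv)
  then show ?thesis
    using assms by (auto simp: lie_centralizer_def left_normed_commutator_def)
qed

lemma zero_mem_lie_centralizer:
  assumes "H \<subseteq> carrier R"
  shows "\<zero> \<in> lie_centralizer R k H"
  using assms
  by (induction k) (auto simp: lie_centralizer_0 lie_centralizer_Suc_iff lie_bracket_zero_left subset_iff)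

lemma one_mem_lie_centralizer:
  assumes "H \<subseteq> carrier R"
  shows "\<one> \<in> lie_centralizer R 1 H"
  using assms
  by (auto simp: lie_centralizer_0 lie_centralizer_Suc_iff lie_bracket_one_left subset_iff)

lemma lie_centralizer_add:
  assumes "H \<subseteq> carrier R"
  shows "\<lbrakk>r \<in> lie_centralizer R k H; s \<in> lie_centralizer R k H\<rbrakk> \<Longrightarrow>
    r \<oplus> s \<in> lie_centralizer R k H"
  using assms
  by (induction k arbitrary: r s)
    (auto simp: lie_centralizer_0 lie_centralizer_Suc_iff lie_bracket_add_left subset_iff)

lemma lie_centralizer_a_inv:
  assumes "H \<subseteq> carrier R"
  shows "r \<in> lie_centralizer R k H \<Longrightarrow> \<ominus> r \<in> lie_centralizer R k H"
  using assms
  by (induction k arbitrary: r)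
    (auto simp: lie_centralizer_0 lie_centralizer_Suc_iff lie_bracket_a_inv_left subset_iff)

text \<open>By the recursion, an inclusion at one index passes to the next; it starts because zero
  lies in every centralizer.\<close>

lemma lie_centralizer_subset_Suc:
  assumes "H \<subseteq> carrier R"
  shows "lie_centralizer R k H \<subseteq> lie_centralizer R (Suc k) H"
proof (induction k)
  case 0
  then show ?case
    using zero_mem_lie_centralizer[OF assms] by (simp add: lie_centralizer_0)
next
  case (Suc k)
  show ?case
    using Suc.IH lie_centralizer_Suc_iff[OF assms, of _ k]
      lie_centralizer_Suc_iff[OF assms, of _ "Suc k"] by blast
qed

lemma lie_centralizer_mono:
  assumes "H \<subseteq> carrier R" "k \<le> l"
  shows "lie_centralizer R k H \<subseteq> lie_centralizer R l H"
  using lift_Suc_mono_le[of "\<lambda>k. lie_centralizer R k H"] lie_centralizer_subset_Suc assms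
  by blast

lemma lie_centralizer_mult:
  assumes H: "H \<subseteq> carrier R"
  shows "\<lbrakk>r \<in> lie_centralizer R p H; s \<in> lie_centralizer R q H\<rbrakk> \<Longrightarrow>
    r \<otimes> s \<in> lie_centralizer R (p + q - 1) H"
proof (induction "p + q" arbitrary: p q r s rule: less_induct)
  case less
  have rs: "r \<in> carrier R" "s \<in> carrier R"
    using less.prems by (auto dest: lie_centralizer_closed)
  show ?case
  \<comment> \<open>If an index is 0, one factor is zero and so is the product; the truncated
    subtraction at \<open>p = q = 0\<close> is then harmless.\<close>
  proof (cases "p = 0 \<or> q = 0")
    case True
    then have "r \<otimes> s = \<zero>"
      using less.prems rs by (auto simp: lie_centralizer_0)
    then show ?thesis
      using zero_mem_lie_centralizer[OF H] by simp
  next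
    case False
    then obtain p' q' where pq: "p = Suc p'" "q = Suc q'"
      by (auto simp: gr0_conv_Suc)
    have "lie_bracket R (r \<otimes> s) x \<in> lie_centralizer R (p' + q') H" if x: "x \<in> H" for x
    proof -
      \<comment> \<open>Both \<open>p' + q - 1\<close> and \<open>p + q' - 1\<close> equal
        \<open>p' + q'\<close>, so the two summands can be added in the same centralizer.\<close>
      have "lie_bracket R r x \<otimes> s \<in> lie_centralizer R (p' + q - 1) H"
        using less.prems x by (intro less.hyps) (auto simp: pq lie_centralizer_Suc_iff[OF H])
      moreover have "r \<otimes> lie_bracket R s x \<in> lie_centralizer R (p + q' - 1) H"
        using less.prems x by (intro less.hyps) (auto simp: pq lie_centralizer_Suc_iff[OF H])
      ultimately show ?thesis
        using rs x subsetD[OF H x] lie_centralizer_add[OF H]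
        by (simp add: pq lie_bracket_mult_left)
    qed
    then show ?thesis
      using rs by (simp add: pq lie_centralizer_Suc_iff[OF H])
  qed
qed

text \<open>The centralizers form an increasing chain, so the larger of two indices serves both
  elements. This reduces closure of the union to closure at a single index.\<close>

lemma omega_lie_centralizer_common_index:
  assumes "H \<subseteq> carrier R" "r \<in> omega_lie_centralizer R H" "s \<in> omega_lie_centralizer R H"
  obtains k where "k \<ge> 1" "r \<in> lie_centralizer R k H" "s \<in> lie_centralizer R k H"
proof -
  obtain p q where "p \<ge> 1" "r \<in> lie_centralizer R p H" "q \<ge> 1" "s \<in> lie_centralizer R q H"
    using assms(2,3) by (auto simp: omega_lie_centralizer_def)
  moreover have "lie_centralizer R p H \<subseteq> lie_centralizer R (max p q) H"
    "lie_centralizer R q H \<subseteq> lie_centralizer R (max p q) H"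
    by (simp_all add: lie_centralizer_mono[OF assms(1)])
  ultimately show thesis
    by (intro that[of "max p q"]) auto
qed

lemma subring_omega_lie_centralizer:
  assumes H: "H \<subseteq> carrier R"
  shows "subring (omega_lie_centralizer R H) R"
proof (rule subringI)
  show "omega_lie_centralizer R H \<subseteq> carrier R"
    by (auto simp: omega_lie_centralizer_def dest: lie_centralizer_closed)
  show "\<one> \<in> omega_lie_centralizer R H"
    using one_mem_lie_centralizer[OF H] by (auto simp: omega_lie_centralizer_def)
next
  fix r assume "r \<in> omega_lie_centralizer R H"
  then show "\<ominus> r \<in> omega_lie_centralizer R H"
    using lie_centralizer_a_inv[OF H] by (auto simp: omega_lie_centralizer_def)
next
  fix r s assume "r \<in> omega_lie_centralizer R H" "s \<in> omega_lie_centralizer R H"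
  then obtain k where k: "k \<ge> 1" "r \<in> lie_centralizer R k H" "s \<in> lie_centralizer R k H"
    using omega_lie_centralizer_common_index[OF H] by blast
  show "r \<oplus> s \<in> omega_lie_centralizer R H"
    using k lie_centralizer_add[OF H] by (auto simp: omega_lie_centralizer_def)
  \<comment> \<open>The union starts at index 1, so the index of the product has to be
    checked.\<close>
  have "k + k - 1 \<ge> 1" using k by simp
  then show "r \<otimes> s \<in> omega_lie_centralizer R H"
    using lie_centralizer_mult[OF H k(2,3)] unfolding omega_lie_centralizer_def by blast
qed

end

context unital_algebra
begin

lemma lie_bracket_smult_left:
  "\<lbrakk>a \<in> carrier K; r \<in> carrier R; x \<in> carrier R\<rbrakk> \<Longrightarrow>
    lie_bracket R (a \<odot> r) x = a \<odot> lie_bracket R r x"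
  by (simp add: lie_bracket_def M.minus_eq smult_mult_left smult_mult_right smult_r_distr smult_r_minus)

lemma lie_centralizer_smult:
  assumes "H \<subseteq> carrier R" "a \<in> carrier K"
  shows "r \<in> lie_centralizer R k H \<Longrightarrow> a \<odot> r \<in> lie_centralizer R k H"
  using assms
  by (induction k arbitrary: r)
    (auto simp: lie_centralizer_0 lie_centralizer_Suc_iff lie_bracket_smult_left subset_iff)

lemma unital_subalgebra_omega_lie_centralizer:
  assumes H: "H \<subseteq> carrier R"
  shows "unital_subalgebra (omega_lie_centralizer R H) K R"
proof -
  interpret subring "omega_lie_centralizer R H" R
    by (rule subring_omega_lie_centralizer[OF H])
  have "a \<odot> r \<in> omega_lie_centralizer R H"
    if "a \<in> carrier K" "r \<in> omega_lie_centralizer R H" for a r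
    using that lie_centralizer_smult[OF H] by (auto simp: omega_lie_centralizer_def)
  \<comment> \<open>The additive subgroup part comes from the interpreted subring; only closure
    under scalars is new.\<close>
  then have "submodule (omega_lie_centralizer R H) K R"
    using subgroup_axioms by (simp add: submodule_def submodule_axioms_def)
  then show ?thesis
    using subring_axioms by (simp add: unital_subalgebra_def)
qed

end

theorem theorem3p5:
  fixes K :: "('k, 'm) ring_scheme" and R :: "('k, 'r, 'n) module_scheme" and H :: "'r set"
  assumes "unital_algebra K R"
    and "H \<subseteq> carrier R"
  shows "(\<forall>p\<ge>1. \<forall>q\<ge>1.
            lie_centralizer R p H <#>\<^bsub>R\<^esub> lie_centralizer R q H \<subseteq> lie_centralizer R (p + q - 1) H)
         \<and> unital_subalgebra (omega_lie_centralizer R H) K R"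
proof -
  interpret unital_algebra K R by fact
  show ?thesis
    using lie_centralizer_mult[OF assms(2)] unital_subalgebra_omega_lie_centralizer[OF assms(2)]
    \<comment> \<open>\<open><#>\<close> collects single products, not their sums, so the
      elementwise product formula suffices.\<close>
    by (auto simp: set_mult_def)
qed

end
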